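(* Let $\ell, m\geq 3$ be integers, and let $a, b\geq 1$ be odd integers with $s(a)=\ell$ and $s(b)=m$. If $s(ab)=4$, then $$\min\{a,b\}<2^{18\ell m}.$$
   Context: For a positive integer $n$, $s(n)$ denotes the number of nonzero digits in the binary expansion of $n$ (e.g. $s(23)=s((10111)_2)=4$). *)

theory Defs
  imports Main
begin

text \<open>The digit of \<open>n\<close> at \<open>2 ^ i\<close> is nonzero iff \<open>bit n i\<close>, i.e. iff \<open>n div 2 ^ i\<close> is odd.\<close>

definition binary_weight :: "nat \<Rightarrow> nat"
  where "binary_weight n = card {i. bit n i}"

text \<open>Only finitely many bits are set, so \<open>card\<close> is not applied to an infinite set.\<close>

lemma finite_bits: "finite {i. bit (n::nat) i}"
proof (rule finite_subset)
  show "{i. bit n i} \<subseteq> {..<n}"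
  proof
    fix i assume "i \<in> {i. bit n i}"
    then have "odd (n div 2 ^ i)" by (simp add: bit_iff_odd)
    then have "2 ^ i \<le> n" by (metis div_less even_zero not_le)
    then have "i < n" using less_exp[of i] by (rule less_le_trans[rotated])
    then show "i \<in> {..<n}" by simp
  qed
qed simp

lemma binary_weight_23: "binary_weight 23 = 4"
proof -
  have "{i. bit (23::nat) i} = {0, 1, 2, 4}"
  proof (rule set_eqI)
    fix i :: nat
    show "i \<in> {i. bit (23::nat) i} \<longleftrightarrow> i \<in> {0, 1, 2, 4}"
    proof (cases "i < 5")
      case True
      then have "i = 0 \<or> i = 1 \<or> i = 2 \<or> i = 3 \<or> i = 4" by linarith
      then show ?thesis by (auto simp: bit_iff_odd)
    next
      case False
      then have "(2::nat) ^ 5 \<le> 2 ^ i" by (intro power_increasing) auto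
      then show ?thesis using False by (auto simp: bit_iff_odd)
    qed
  qed
  then show ?thesis by (simp add: binary_weight_def)
qed

end

theory Submission
  imports Defs "HOL-Computational_Algebra.Primes"
begin

text \<open>
  Let \<open>A\<close> and \<open>B\<close> be the sets of positions of the ones of \<open>a\<close> and \<open>b\<close>, put \<open>W = l * m\<close>, and suppose that
  both \<open>M = Max A\<close> and \<open>N = Max B\<close> are at least \<open>18 * W\<close>.  The product is the sum of the \<open>W\<close> powers
  \<open>2 ^ (i + j)\<close> with \<open>(i, j) \<in> A \<times> B\<close>.

  Carry out this addition column by column and call a column active if it receives a summand or a
  carry.  An active column passes on strictly less than it receives, so at most \<open>W\<close> columns are
  active (\<open>card_active\<close>).  The last column of a run of active columns has received exactly one unit, so
  it carries a digit 1 of the product (\<open>run_end_bit\<close>).  Hence the sumset \<open>A + B\<close>, which contains \<open>A\<close> and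
  \<open>B\<close>, lies in at most four runs of total length at most \<open>W\<close>.

  Merging runs whose gaps are small gives clusters whose gaps are more than twice as long as the
  clusters themselves (\<open>separating_scale\<close>).  At least three clusters remain, because two of them would
  be too short to reach up to \<open>M\<close> and \<open>N\<close>.  At such a scale the cluster of \<open>i + j\<close> depends only on the
  clusters of \<open>i\<close> and \<open>j\<close> and is strictly increasing in both, as for exponents of polynomials, and no
  carry leaves a cluster, so the four digits 1 of \<open>a * b\<close> are shared out among the clusters, each
  receiving at least one (\<open>product_clusters\<close>).

  Write \<open>a\<^sub>0\<close>, \<open>b\<^sub>0\<close> for the parts of \<open>a\<close>, \<open>b\<close> in their lowest clusters and \<open>a\<^sub>1\<close>, \<open>b\<^sub>1\<close> for the parts in their
  highest clusters.  The lowest and highest clusters of the product are \<open>a\<^sub>0 * b\<^sub>0\<close> and \<open>a\<^sub>1 * b\<^sub>1\<close>.  If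
  both have weight 1, all four factors are powers of two; as \<open>l\<close> and \<open>m\<close> are at least 3, both \<open>a\<close> and
  \<open>b\<close> have a further cluster in between, and this produces five clusters in the product, too many.
  Otherwise there are exactly three clusters, \<open>a = a\<^sub>0 + a\<^sub>1\<close>, \<open>b = b\<^sub>0 + b\<^sub>1\<close>, the middle cluster
  \<open>a\<^sub>0 * b\<^sub>1 + b\<^sub>0 * a\<^sub>1\<close> is a power of two, and one of \<open>a\<^sub>0 * b\<^sub>0\<close>, \<open>a\<^sub>1 * b\<^sub>1\<close> has weight 1 and the other weight 2.
  A congruence modulo 8 (\<open>sum_power_prod_weight_2\<close>) then forces another factor to be a power of two,
  so that \<open>a\<close> or \<open>b\<close> has weight 2, a contradiction.
\<close>

section \<open>Binary weight\<close>

lemma bit_add_disjoint: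
  assumes "\<And>i. \<not> (bit x i \<and> bit y i)"
  shows "bit (x + y :: nat) i \<longleftrightarrow> bit x i \<or> bit y i"
proof -
  have "and x y = 0" using assms by (auto simp: bit_eq_iff bit_simps)
  then have "x + y = or x y" by (simp add: disjunctive_add_eq_or)
  then show ?thesis by (simp add: bit_or_iff)
qed

lemma bit_sum_powers:
  assumes "finite A"
  shows "bit (\<Sum>i\<in>A. 2 ^ i :: nat) k \<longleftrightarrow> k \<in> A"
  using assms
proof (induction A arbitrary: k rule: finite_induct)
  case (insert x F)
  then have "bit (2 ^ x + (\<Sum>i\<in>F. 2 ^ i) :: nat) k \<longleftrightarrow> bit (2 ^ x :: nat) k \<or> bit (\<Sum>i\<in>F. 2 ^ i :: nat) k"
    by (intro bit_add_disjoint) (auto simp: bit_exp_iff)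
  with insert show ?case by (auto simp: bit_exp_iff)
qed simp

lemma sum_bits: "(\<Sum>i | bit n i. 2 ^ i) = (n :: nat)"
  by (rule bit_eqI) (simp add: bit_sum_powers finite_bits)

lemma binary_weight_sum_powers: "finite A \<Longrightarrow> binary_weight (\<Sum>i\<in>A. 2 ^ i) = card A"
  by (simp add: binary_weight_def bit_sum_powers)

lemma binary_weight_eq_0_iff: "binary_weight n = 0 \<longleftrightarrow> n = 0"
  using sum_bits[of n] finite_bits[of n] by (auto simp: binary_weight_def)

lemma binary_weight_power_mult: "binary_weight (2 ^ k * n) = binary_weight n"
proof -
  have "{i. bit (2 ^ k * n) i} = (\<lambda>i. i + k) ` {i. bit n i}"
  proof (rule set_eqI)
    fix i
    have "bit (2 ^ k * n) i \<longleftrightarrow> k \<le> i \<and> bit n (i - k)"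
      by (simp add: bit_push_bit_iff flip: push_bit_eq_mult mult.commute[of n])
    also have "\<dots> \<longleftrightarrow> i \<in> (\<lambda>i. i + k) ` {i. bit n i}"
      by (auto simp: image_iff intro!: exI[of _ "i - k"])
    finally show "i \<in> {i. bit (2 ^ k * n) i} \<longleftrightarrow> i \<in> (\<lambda>i. i + k) ` {i. bit n i}" by simp
  qed
  then show ?thesis by (simp add: binary_weight_def card_image)
qed

lemma binary_weight_eq_1_iff: "binary_weight n = 1 \<longleftrightarrow> (\<exists>k. n = 2 ^ k)"
proof
  assume "binary_weight n = 1"
  then obtain k where "{i. bit n i} = {k}" by (auto simp: binary_weight_def card_1_singleton_iff)
  then show "\<exists>k. n = 2 ^ k" using sum_bits[of n] by auto
next
  assume "\<exists>k. n = 2 ^ k"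
  then show "binary_weight n = 1" using binary_weight_sum_powers[of "{k}" for k] by auto
qed

lemma binary_weight_mult_eq_1:
  assumes "binary_weight (x * y) = 1"
  shows "binary_weight x = 1" "binary_weight y = 1"
proof -
  obtain k where k: "x * y = 2 ^ k" using assms unfolding binary_weight_eq_1_iff by blast
  have "x dvd 2 ^ k" "y dvd 2 ^ k" using k by (metis dvd_triv_left dvd_triv_right)+
  then show "binary_weight x = 1" "binary_weight y = 1"
    by (auto simp only: divides_primepow_nat[OF two_is_prime_nat] binary_weight_eq_1_iff)
qed

text \<open>
  If the sum is at most 4, the odd numbers \<open>x\<close> and \<open>y\<close> cannot both be at least 3.
  A sum divisible by 8 gives
  \<open>x * y \<equiv> - x\<^sup>2 \<equiv> 7\<close> modulo 8, but no number \<open>1 + 2 ^ k\<close> is 7 modulo 8.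
\<close>

lemma odd_sum_power_prod_weight_2:
  fixes x y :: nat
  assumes "odd x" "odd y" "x + y = 2 ^ d" "binary_weight (x * y) = 2"
  shows "x = 1 \<or> y = 1"
proof (cases "d \<ge> 3")
  case True
  obtain i j where ij: "{i. bit (x * y) i} = {i, j}" "i \<noteq> j"
    using assms(4) by (auto simp: binary_weight_def card_2_iff)
  have "0 \<in> {i. bit (x * y) i}" using assms by (simp add: bit_0)
  then obtain k where k: "{i. bit (x * y) i} = {0, k}" "k \<noteq> 0" using ij by (metis insertE insert_commute empty_iff)
  then have xy: "x * y = 1 + 2 ^ k" using sum_bits[of "x * y"] by simp
  have "8 dvd x + y" using le_imp_power_dvd[OF True, of "2::nat"] assms(3) by simp
  have "(x mod 8) * (y mod 8) mod 8 = (1 + 2 ^ k) mod 8"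
    using xy by (simp add: mod_mult_eq)
  moreover have "(x mod 8) * (y mod 8) mod 8 = 7"
  proof -
    have "(x mod 8 + y mod 8) mod 8 = 0" using \<open>8 dvd x + y\<close> by (simp add: mod_add_eq)
    moreover have "x mod 8 \<in> {1,3,5,7}" "y mod 8 \<in> {1,3,5,7}"
      using assms(1,2) by - (simp, presburger)+
    ultimately show ?thesis by (auto dest: dvd_imp_le)
  qed
  moreover have "(1 + 2 ^ k :: nat) mod 8 \<noteq> 7"
  proof -
    consider "k = 1" | "k = 2" | j where "k = j + 3"
      using k(2) by (metis One_nat_def Suc_1 Suc_leI add.commute le_Suc_ex less_Suc_eq neq0_conv not_less numeral_3_eq_3)
    then show ?thesis
    proof cases
      case 3
      then have "(1 + 2 ^ k :: nat) = 1 + 8 * 2 ^ j" by (simp add: power_add)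
      then show ?thesis by presburger
    qed simp_all
  qed
  ultimately show ?thesis by simp
next
  case False
  then have "d = 0 \<or> d = 1 \<or> d = 2" by linarith
  then have "x + y \<le> 4" using assms(3) by auto
  then show ?thesis using assms(1,2) by presburger
qed

text \<open>
  After the powers of two in \<open>x\<close> and \<open>y\<close> are absorbed into \<open>2 ^ i\<close> and \<open>2 ^ j\<close>, the two exponents must
  agree, since otherwise the odd part of the sum would be an odd number greater than 1.  This
  reduces the claim to odd \<open>x\<close> and \<open>y\<close>.
\<close>

lemma sum_power_prod_weight_2:
  assumes "binary_weight (2 ^ i * x + 2 ^ j * y) = 1" "binary_weight (x * y) = 2"
  shows "binary_weight x = 1 \<or> binary_weight y = 1"
proof -
  have "x * y \<noteq> 0" using assms(2) binary_weight_eq_0_iff[of "x * y"] by auto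
  then have "x \<noteq> 0" "y \<noteq> 0" by auto
  obtain p u where x: "x = 2 ^ p * u" "odd u"
    using \<open>x \<noteq> 0\<close> multiplicity_decompose'[of x 2] by (metis not_is_unit_0 odd_one prime_elem_nat_iff two_is_prime_nat)
  obtain q v where y: "y = 2 ^ q * v" "odd v"
    using \<open>y \<noteq> 0\<close> multiplicity_decompose'[of y 2] by (metis not_is_unit_0 odd_one prime_elem_nat_iff two_is_prime_nat)
  have uv: "binary_weight (u * v) = 2"
    using assms(2) binary_weight_power_mult[of "p + q" "u * v"] by (simp add: x y power_add ac_simps)
  have main: "r = s \<and> binary_weight (u' + v') = 1"
    if "binary_weight (2 ^ r * u' + 2 ^ s * v') = 1" "r \<le> s" "odd u'" "odd v'" for r s u' v'
  proof -
    have "2 ^ r * u' + 2 ^ s * v' = 2 ^ r * (u' + 2 ^ (s - r) * v')"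
      using \<open>r \<le> s\<close> by (simp add: algebra_simps flip: power_add)
    then have w: "binary_weight (u' + 2 ^ (s - r) * v') = 1"
      using that(1) by (simp add: binary_weight_power_mult)
    then obtain k where k: "u' + 2 ^ (s - r) * v' = 2 ^ k" unfolding binary_weight_eq_1_iff by blast
    have "u' \<ge> 1" "2 ^ (s - r) * v' \<ge> 1" using that(3,4) by (simp_all add: Suc_le_eq odd_pos)
    then have "2 ^ k \<noteq> (1 :: nat)" using k by linarith
    then have "k \<noteq> 0" by (intro notI) simp
    have "r = s"
    proof (rule ccontr)
      assume "r \<noteq> s"
      then have "odd (u' + 2 ^ (s - r) * v')" using that by simp
      then show False using k \<open>k \<noteq> 0\<close> by simp
    qed
    then show ?thesis using w by simp
  qed
  have "binary_weight (2 ^ (i + p) * u + 2 ^ (j + q) * v) = 1"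
    using assms(1) by (simp add: x y power_add ac_simps)
  then have "binary_weight (u + v) = 1"
    using main[of "i + p" u "j + q" v] main[of "j + q" v "i + p" u] x y
    by (metis add.commute nat_le_linear)
  then obtain d where "u + v = 2 ^ d" unfolding binary_weight_eq_1_iff by blast
  then have "u = 1 \<or> v = 1" using odd_sum_power_prod_weight_2 x y uv by blast
  then show ?thesis
  proof
    assume "u = 1"
    then have "x = 2 ^ p" using x(1) by simp
    then show ?thesis using binary_weight_eq_1_iff by blast
  next
    assume "v = 1"
    then have "y = 2 ^ q" using y(1) by simp
    then show ?thesis using binary_weight_eq_1_iff by blast
  qed
qed

section \<open>Carries in a sum of powers of two\<close>

text \<open>
  The carry that enters column \<open>k\<close> when the powers \<open>2 ^ h x\<close>, \<open>x \<in> X\<close>, are added in binary.  The recursion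
  of column addition is \<open>carry_into_Suc\<close>.
\<close>

definition carry_into :: "'a set \<Rightarrow> ('a \<Rightarrow> nat) \<Rightarrow> nat \<Rightarrow> nat"
  where "carry_into X h k = (\<Sum>x | x \<in> X \<and> h x < k. 2 ^ h x) div 2 ^ k"

definition active :: "'a set \<Rightarrow> ('a \<Rightarrow> nat) \<Rightarrow> nat set"
  where "active X h = {k. carry_into X h k + card {x \<in> X. h x = k} > 0}"

context
  fixes X :: "'a set" and h :: "'a \<Rightarrow> nat"
  assumes fin: "finite X"
begin

lemma sum_below_Suc:
  "(\<Sum>x | x \<in> X \<and> h x < Suc k. 2 ^ h x) =
     (\<Sum>x | x \<in> X \<and> h x < k. 2 ^ h x) + card {x \<in> X. h x = k} * (2 ^ k :: nat)"
proof -
  have "(\<Sum>x | x \<in> X \<and> h x < Suc k. 2 ^ h x :: nat) =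
     (\<Sum>x \<in> {x. x \<in> X \<and> h x < k} \<union> {x \<in> X. h x = k}. 2 ^ h x)"
    by (rule sum.cong) auto
  also have "\<dots> = (\<Sum>x | x \<in> X \<and> h x < k. 2 ^ h x) + (\<Sum>x \<in> {x \<in> X. h x = k}. 2 ^ h x)"
    using fin by (intro sum.union_disjoint) auto
  also have "(\<Sum>x \<in> {x \<in> X. h x = k}. 2 ^ h x :: nat) = card {x \<in> X. h x = k} * 2 ^ k" by simp
  finally show ?thesis .
qed

lemma sum_below_Suc_div:
  "(\<Sum>x | x \<in> X \<and> h x < Suc k. 2 ^ h x) div 2 ^ k = carry_into X h k + card {x \<in> X. h x = k}"
  by (simp add: sum_below_Suc carry_into_def)

lemma carry_into_Suc:
  "carry_into X h (Suc k) = (carry_into X h k + card {x \<in> X. h x = k}) div 2"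
  by (simp add: carry_into_def[of _ _ "Suc k"] power_Suc2 div_mult2_eq sum_below_Suc_div del: power_Suc)

lemma sum_split_below:
  "\<exists>z. (\<Sum>x\<in>X. 2 ^ h x) = (\<Sum>x | x \<in> X \<and> h x < k. 2 ^ h x) + 2 ^ k * (z :: nat)"
proof -
  have "(\<Sum>x\<in>X. 2 ^ h x :: nat) = (\<Sum>x \<in> {x. x \<in> X \<and> h x < k} \<union> {x \<in> X. k \<le> h x}. 2 ^ h x)"
    by (rule sum.cong) auto
  also have "\<dots> = (\<Sum>x | x \<in> X \<and> h x < k. 2 ^ h x) + (\<Sum>x \<in> {x \<in> X. k \<le> h x}. 2 ^ h x)"
    using fin by (intro sum.union_disjoint) auto
  finally have eq: "(\<Sum>x\<in>X. 2 ^ h x :: nat) = \<dots>" .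
  have "2 ^ k dvd (\<Sum>x \<in> {x \<in> X. k \<le> h x}. 2 ^ h x :: nat)"
    by (rule dvd_sum) (auto intro: le_imp_power_dvd)
  with eq show ?thesis by (auto elim: dvdE)
qed

lemma bit_sum_iff_odd:
  "bit (\<Sum>x\<in>X. 2 ^ h x :: nat) k \<longleftrightarrow> odd (carry_into X h k + card {x \<in> X. h x = k})"
proof -
  obtain z where z: "(\<Sum>x\<in>X. 2 ^ h x) = (\<Sum>x | x \<in> X \<and> h x < Suc k. 2 ^ h x) + 2 ^ Suc k * (z :: nat)"
    using sum_split_below by blast
  have "(\<Sum>x\<in>X. 2 ^ h x) div 2 ^ k = carry_into X h k + card {x \<in> X. h x = k} + 2 * z"
    unfolding z sum_below_Suc_div[symmetric] by (simp add: power_Suc2 mult.assoc del: power_Suc)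
  then show ?thesis by (simp add: bit_iff_odd)
qed

text \<open>
  The number of units entering an active column exceeds the number of carries leaving it by at least
  one.  Telescoping over the columns below \<open>n\<close> bounds the number of active ones by the number of
  summands.
\<close>

lemma active_below:
  "card (active X h \<inter> {..<n}) + carry_into X h n \<le> card {x \<in> X. h x < n}"
proof (induction n)
  case (Suc n)
  have "{x \<in> X. h x < Suc n} = {x \<in> X. h x < n} \<union> {x \<in> X. h x = n}" by auto
  then have "card {x \<in> X. h x < Suc n} = card {x \<in> X. h x < n} + card {x \<in> X. h x = n}"
    using fin by (simp add: card_Un_disjoint disjoint_iff)
  moreover have "card (active X h \<inter> {..<Suc n}) =
      card (active X h \<inter> {..<n}) + (if n \<in> active X h then 1 else 0)"
    by (simp add: lessThan_Suc)
  ultimately show ?case using Suc carry_into_Suc[of n] by (auto simp: active_def)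
qed (simp add: carry_into_def)

lemma finite_active: "finite (active X h)"
  and card_active: "card (active X h) \<le> card X"
proof -
  have *: "card F \<le> card X" if "finite F" "F \<subseteq> active X h" for F
  proof -
    obtain n where "\<forall>k\<in>F. k < n" using \<open>finite F\<close> by (meson finite_nat_set_iff_bounded)
    then have "F \<subseteq> active X h \<inter> {..<n}" using that by auto
    then have "card F \<le> card (active X h \<inter> {..<n})" by (intro card_mono) auto
    also have "\<dots> \<le> card {x \<in> X. h x < n}" using active_below[of n] by linarith
    also have "\<dots> \<le> card X" using fin by (intro card_mono) auto
    finally show ?thesis .
  qed
  show "finite (active X h)"
    using * by (metis infinite_arbitrarily_large not_less_eq_eq order_refl)
  then show "card (active X h) \<le> card X" using * by blast
qed

lemma exponent_active: "x \<in> X \<Longrightarrow> h x \<in> active X h"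
  using fin by (auto simp: active_def card_gt_0_iff)

lemma bit_active: "bit (\<Sum>x\<in>X. 2 ^ h x :: nat) k \<Longrightarrow> k \<in> active X h"
  by (auto simp: bit_sum_iff_odd active_def intro: Nat.gr0I)

text \<open>
  A column that receives two or more units passes a carry on, so the last column of a run receives
  exactly one.
\<close>

lemma run_end_bit: "k \<in> active X h \<Longrightarrow> Suc k \<notin> active X h \<Longrightarrow> bit (\<Sum>x\<in>X. 2 ^ h x :: nat) k"
proof -
  assume "k \<in> active X h" "Suc k \<notin> active X h"
  then have "carry_into X h k + card {x \<in> X. h x = k} = 1"
    using carry_into_Suc[of k] by (auto simp: active_def div_eq_0_iff)
  then show ?thesis by (simp add: bit_sum_iff_odd)
qed

lemma sum_below_cut:
  assumes "carry_into X h k = 0"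
  shows "(\<Sum>x | x \<in> X \<and> h x < k. 2 ^ h x :: nat) = take_bit k (\<Sum>x\<in>X. 2 ^ h x)"
proof -
  have "(\<Sum>x | x \<in> X \<and> h x < k. 2 ^ h x :: nat) < 2 ^ k"
    using assms by (simp add: carry_into_def div_eq_0_iff)
  moreover obtain z where "(\<Sum>x\<in>X. 2 ^ h x) = (\<Sum>x | x \<in> X \<and> h x < k. 2 ^ h x) + 2 ^ k * (z :: nat)"
    using sum_split_below by blast
  ultimately show ?thesis by (simp add: take_bit_eq_mod)
qed

end

section \<open>Clusters of a finite set of positions\<close>

text \<open>
  If runs separated by gaps of at most \<open>g\<close> are merged, these are the right ends of the merged runs;
  \<open>g = 1\<close> gives the ends of the maximal blocks of consecutive elements.
\<close>

definition run_ends :: "nat \<Rightarrow> nat set \<Rightarrow> nat set"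
  where "run_ends g K = {x \<in> K. \<forall>y\<in>K. x < y \<longrightarrow> x + g < y}"

lemma run_ends_subset: "run_ends g K \<subseteq> K"
  by (auto simp: run_ends_def)

lemma run_ends_antimono: "g \<le> g' \<Longrightarrow> run_ends g' K \<subseteq> run_ends g K"
  by (force simp: run_ends_def)

text \<open>
  A merged run consists of elements of \<open>K\<close> and of gaps that were closed.  Each closed gap has length
  at most \<open>g\<close> and follows the end of a block that is not the end of a merged run.
\<close>

lemma run_length:
  assumes "finite K" "u \<in> K" "v \<in> K" "u \<le> v" "run_ends g K \<inter> {u..<v} = {}" "g > 0"
  shows "v < u + card K + g * card (run_ends 1 K - run_ends g K)"
proof -
  let ?D = "run_ends 1 K - run_ends g K"
  have fin: "finite ?D" using assms(1) run_ends_subset finite_subset by blast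
  have sub: "{u..v} \<subseteq> K \<union> (\<Union>x\<in>?D. {x<..x + g})"
  proof
    fix y assume y: "y \<in> {u..v}"
    show "y \<in> K \<union> (\<Union>x\<in>?D. {x<..x + g})"
    proof (cases "y \<in> K")
      case False
      \<comment> \<open>The block end just before the gap that contains \<open>y\<close>.\<close>
      define x where "x = Max (K \<inter> {..<y})"
      have "u < y" using y False assms(2) by (cases "u = y") auto
      then have ne: "K \<inter> {..<y} \<noteq> {}" using assms(2) by auto
      have x: "x \<in> K" "x < y" and "u \<le> x" and max: "\<And>z. z \<in> K \<Longrightarrow> z < y \<Longrightarrow> z \<le> x"
        using Max_in[of "K \<inter> {..<y}"] Max_ge[of "K \<inter> {..<y}"] ne assms(1,2) \<open>u < y\<close> by (auto simp: x_def)
      have skip: "y < z" if "z \<in> K" "x < z" for z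
        using max[of z] that False by (metis linorder_neqE_nat not_le)
      have "y \<le> v" "y \<noteq> v" using y False assms(3) by auto
      then have "x \<notin> run_ends g K" using assms(5) x \<open>u \<le> x\<close> by auto
      then obtain z where "z \<in> K" "x < z" "z \<le> x + g" using x by (auto simp: run_ends_def not_less)
      moreover have "x \<in> run_ends 1 K" using x skip by (force simp: run_ends_def)
      ultimately show ?thesis using \<open>x \<notin> run_ends g K\<close> skip x by force
    qed simp
  qed
  have "Suc v - u = card {u..v}" by simp
  also have "\<dots> \<le> card (K \<union> (\<Union>x\<in>?D. {x<..x + g}))"
    using sub fin assms(1) by (intro card_mono) auto
  also have "\<dots> \<le> card K + card (\<Union>x\<in>?D. {x<..x + g})" by (rule card_Un_le)
  also have "card (\<Union>x\<in>?D. {x<..x + g}) \<le> (\<Sum>x\<in>?D. card {x<..x + g})"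
    by (rule card_UN_le[OF fin])
  also have "\<dots> = g * card ?D" by simp
  finally show ?thesis using assms(4) by linarith
qed

text \<open>
  A scale \<open>g\<close> at which gaps are longer than \<open>2 * (L - 1)\<close> while every merged run is shorter than \<open>L\<close>, so
  that the sumset of two merged runs fits into a single one.  With four runs at scale \<open>2 * W\<close> nothing is
  merged and \<open>L = W\<close> works.  If only three are left at scale \<open>2 * W\<close>, and still three at \<open>6 * W\<close>, then at
  most one gap was closed, of length at most \<open>2 * W\<close>, and \<open>g = 6 * W\<close>, \<open>L = 3 * W\<close> works.  With two runs at scale
  \<open>6 * W\<close> each would be shorter than \<open>13 * W\<close>, but one of the intervals from \<open>0\<close> to \<open>M\<close> and from \<open>M\<close> to
  \<open>M + M'\<close> lies inside a run.  With one run everything would be shorter than \<open>19 * W\<close>.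
\<close>

lemma separating_scale:
  assumes K: "finite K" "card K \<le> W" "card (run_ends 1 K) \<le> 4" "W > 0"
    and M: "0 \<in> K" "M \<in> K" "M' \<in> K" "M + M' \<in> K" "18 * W \<le> M" "18 * W \<le> M'"
  obtains g L where "g > 0" "L > 0" "2 * L \<le> g + 2" "L \<le> 3 * W" "card (run_ends g K) \<ge> 3"
    "\<And>u v. u \<in> K \<Longrightarrow> v \<in> K \<Longrightarrow> u \<le> v \<Longrightarrow> run_ends g K \<inter> {u..<v} = {} \<Longrightarrow> v < u + L"
proof -
  have fin: "finite (run_ends g K)" for g using K(1) run_ends_subset finite_subset by blast
  have diff: "card (run_ends 1 K - run_ends g K) + card (run_ends g K) \<le> 4" if "g > 0" for g
    using that run_ends_antimono[of 1 g K] fin[of g] fin[of 1] K(3)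
    by (simp add: card_Diff_subset card_mono)
  have len: "v < u + (W + g * d)"
    if "u \<in> K" "v \<in> K" "u \<le> v" "run_ends g K \<inter> {u..<v} = {}" "g > 0"
      "card (run_ends 1 K - run_ends g K) \<le> d" for u v g d
    using run_length[OF K(1) that(1-5)] K(2) mult_le_mono2[OF that(6), of g] by linarith
  have three: "card (run_ends (6 * W) K) \<ge> 3"
  proof (rule ccontr)
    let ?E = "run_ends (6 * W) K"
    assume "\<not> ?thesis"
    then have le2: "card ?E \<le> 2" by simp
    have MaxE: "Max K \<in> ?E" using Max_in[OF K(1)] M(1) Max_ge[OF K(1)] by (auto simp: run_ends_def simp flip: not_le)
    have MaxM: "M + M' \<le> Max K" using K(1) M(4) by simp
    show False
    proof (cases "?E \<inter> {0..<M + M'} = {}")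
      case True
      have "card ?E > 0" using MaxE fin by (auto simp: card_gt_0_iff)
      then have "card (run_ends 1 K - ?E) \<le> 3" using diff[of "6 * W"] K(4) by linarith
      from len[OF M(1) M(4) _ True _ this] show False using K(4) M by simp
    next
      case False
      then obtain e where e: "e \<in> ?E" "e < M + M'" by auto
      then have "card {e, Max K} = 2" using MaxM by auto
      then have E: "?E = {e, Max K}" using le2 e MaxE fin
        by (metis card_seteq empty_subsetI insert_subset)
      then have "card (run_ends 1 K - ?E) \<le> 2" using diff[of "6 * W"] \<open>card {e, Max K} = 2\<close> K(4) by simp
      note l = len[OF _ _ _ _ _ this]
      show False
      proof (cases "e < M")
        case True
        have "M + M' < M + (W + 6 * W * 2)" using M E True MaxM K(4) by (intro l) auto
        then show False using M K(4) by simp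
      next
        case False
        have "M < 0 + (W + 6 * W * 2)" using M E False MaxM K(4) by (intro l) auto
        then show False using M K(4) by simp
      qed
    qed
  qed
  have mono: "run_ends (6 * W) K \<subseteq> run_ends (2 * W) K" by (rule run_ends_antimono) simp
  show ?thesis
  proof (cases "card (run_ends (2 * W) K) = 4")
    case True
    then have "card (run_ends 1 K - run_ends (2 * W) K) \<le> 0" using diff[of "2 * W"] K(4) by simp
    from len[OF _ _ _ _ _ this] show ?thesis using K(4) True by (intro that[of "2 * W" W]) auto
  next
    case False
    then have "card (run_ends (2 * W) K) \<le> 3" using diff[of "2 * W"] K(4) by simp
    then have E: "run_ends (6 * W) K = run_ends (2 * W) K"
      using three by (intro card_seteq[OF fin mono]) simp
    have "card (run_ends 1 K - run_ends (2 * W) K) \<le> 1" using diff[of "2 * W"] K(4) three E by simp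
    \<comment> \<open>The runs at the scales \<open>2 * W\<close> and \<open>6 * W\<close> coincide; the smaller scale bounds their length.\<close>
    from len[OF _ _ _ _ _ this] show ?thesis
      using K(4) three by (intro that[of "6 * W" "3 * W"]) (auto simp: E mult.commute[of W])
  qed
qed

text \<open>
  Clusters are numbered from 0 by counting the ends to the left.  Positions in a gap are given the
  number of the next cluster, which makes the number a monotone function on all of \<open>nat\<close>.
\<close>

definition cluster :: "nat set \<Rightarrow> nat \<Rightarrow> nat"
  where "cluster E k = card {e \<in> E. e < k}"

lemma cluster_0 [simp]: "cluster E 0 = 0"
  by (simp add: cluster_def)

lemma cluster_mono: "finite E \<Longrightarrow> u \<le> v \<Longrightarrow> cluster E u \<le> cluster E v"
  by (auto simp: cluster_def intro!: card_mono)

lemma cluster_eq: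
  assumes "finite E" "u \<le> v"
  shows "cluster E v = cluster E u + card (E \<inter> {u..<v})"
proof -
  have "{e \<in> E. e < v} = {e \<in> E. e < u} \<union> (E \<inter> {u..<v})" using assms(2) by auto
  then show ?thesis using assms(1) by (simp add: cluster_def card_Un_disjoint disjoint_iff)
qed

lemma cluster_eq_iff:
  assumes "finite E" "u \<le> v"
  shows "cluster E u = cluster E v \<longleftrightarrow> E \<inter> {u..<v} = {}"
  using cluster_eq[OF assms] assms(1) by auto

lemma cluster_Suc: "finite E \<Longrightarrow> cluster E (Suc k) = cluster E k + (if k \<in> E then 1 else 0)"
  using cluster_eq[of E k "Suc k"] by simp

lemma cluster_threshold:
  assumes "finite E" "0 < t" "t \<le> card E"
  obtains e where "e \<in> E" "cluster E e = t - 1" "\<And>k. cluster E k < t \<longleftrightarrow> k \<le> e"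
proof -
  define k where "k = (LEAST k. t \<le> cluster E k)"
  have "{e \<in> E. e < Suc (Max E)} = E" using assms(1) by (auto simp: less_Suc_eq_le)
  then have ex: "t \<le> cluster E (Suc (Max E))" using assms(3) by (simp add: cluster_def)
  have k: "t \<le> cluster E k" unfolding k_def by (rule LeastI[of "\<lambda>k. t \<le> cluster E k", OF ex])
  have least: "cluster E j < t" if "j < k" for j
    using not_less_Least[of j "\<lambda>k. t \<le> cluster E k"] that by (simp add: k_def)
  obtain e where e: "k = Suc e" using k assms(2) by (cases k) auto
  have "cluster E e < t" using least e by simp
  then have "e \<in> E" "cluster E e = t - 1"
    using k cluster_Suc[OF assms(1), of e] by (auto simp: e split: if_splits)
  moreover have "cluster E j < t \<longleftrightarrow> j \<le> e" for j
    using least[of j] cluster_mono[OF assms(1), of k j] k by (cases "j < k") (auto simp: e)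
  ultimately show ?thesis using that by blast
qed

text \<open>
  If no carry leaves a cluster, the summands with exponents in it produce exactly the digits of the
  total sum in it.  The claim is the difference of two statements about all clusters below a
  threshold, where the partial sum is the total sum reduced modulo a power of two.
\<close>

lemma sum_cluster:
  assumes fin: "finite X" "finite E" and cut: "\<And>e. e \<in> E \<Longrightarrow> carry_into X h (Suc e) = 0"
    and "t < card E"
  shows "(\<Sum>x | x \<in> X \<and> cluster E (h x) = t. 2 ^ h x :: nat) =
    (\<Sum>i | bit (\<Sum>x\<in>X. 2 ^ h x :: nat) i \<and> cluster E i = t. 2 ^ i :: nat)"
proof -
  define n :: nat where "n = (\<Sum>x\<in>X. 2 ^ h x)"
  have below: "(\<Sum>x | x \<in> X \<and> cluster E (h x) < s. 2 ^ h x :: nat) =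
      (\<Sum>i | bit n i \<and> cluster E i < s. 2 ^ i)" if s: "s \<le> card E" for s
  proof (cases "s = 0")
    case False
    then have "0 < s" by simp
    from cluster_threshold[OF fin(2) this s]
    obtain e where e: "e \<in> E" "\<And>k. cluster E k < s \<longleftrightarrow> k \<le> e" by metis
    have "(\<Sum>i | bit n i \<and> i < Suc e. 2 ^ i :: nat) = take_bit (Suc e) n"
      by (rule bit_eqI) (auto simp: bit_sum_powers finite_bits bit_take_bit_iff)
    then show ?thesis
      using sum_below_cut[OF fin(1) cut[OF e(1)]] by (simp add: e(2) n_def less_Suc_eq_le)
  qed simp
  have split: "(\<Sum>x | x \<in> Y \<and> cluster E (f x) < Suc t. 2 ^ f x) =
      (\<Sum>x | x \<in> Y \<and> cluster E (f x) < t. 2 ^ f x) + (\<Sum>x | x \<in> Y \<and> cluster E (f x) = t. 2 ^ f x :: nat)"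
    if "finite Y" for Y :: "'c set" and f
  proof -
    have "{x. x \<in> Y \<and> cluster E (f x) < Suc t} =
        {x. x \<in> Y \<and> cluster E (f x) < t} \<union> {x. x \<in> Y \<and> cluster E (f x) = t}" by auto
    then show ?thesis using that by (simp add: sum.union_disjoint disjoint_iff)
  qed
  show ?thesis
    using below[of t] below[of "Suc t"] split[OF fin(1), of h] split[OF finite_bits[of n], of "\<lambda>i. i"] assms(4)
    by (simp add: n_def)
qed

section \<open>Products of binary weight four\<close>

lemma sum_powers_Times:
  "finite A \<Longrightarrow> finite B \<Longrightarrow>
    (\<Sum>p\<in>A \<times> B. 2 ^ (fst p + snd p)) = (\<Sum>i\<in>A. 2 ^ i) * (\<Sum>j\<in>B. 2 ^ j :: nat)"
  by (simp add: sum_product sum.cartesian_product power_add case_prod_beta)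

lemma Max_bits_ge:
  fixes n :: nat
  assumes "2 ^ k \<le> n"
  shows "k \<le> Max {i. bit n i}"
proof (rule ccontr)
  assume *: "\<not> ?thesis"
  have "i < k" if "bit n i" for i
    using * Max_ge[OF finite_bits[of n], of i] that by simp
  then have "take_bit k n = n" by (intro bit_eqI) (auto simp: bit_take_bit_iff)
  then have "n < 2 ^ k" by (metis take_bit_nat_less_exp)
  with assms show False by simp
qed

text \<open>
  The function \<open>c\<close> numbers the \<open>R\<close> clusters of the active columns of the product at a separating scale.
  Two positions in one cluster are at distance less than \<open>L\<close>, positions in different clusters at
  distance more than \<open>g \<ge> 2 * (L - 1)\<close>.  Since all sums \<open>i + j\<close> are active, changing \<open>i\<close> and \<open>j\<close> inside their
  clusters moves the sum by at most \<open>g\<close> and keeps its cluster, while moving \<open>i\<close> or \<open>j\<close> to a higher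
  cluster moves the sum by more than \<open>g\<close>.
\<close>

lemma product_clusters:
  fixes a b :: nat
  defines "A \<equiv> {i. bit a i}" and "B \<equiv> {j. bit b j}"
  assumes "odd a" "odd b" and w4: "binary_weight (a * b) = 4"
    and large: "18 * (card A * card B) \<le> Max A" "18 * (card A * card B) \<le> Max B"
  obtains c :: "nat \<Rightarrow> nat" and R where
    "mono c" "c 0 = 0" "c (Max A) > 0" "c (Max B) > 0" "R \<ge> 3" "c (Max A + Max B) = R - 1"
    "\<And>i i' j. i \<in> A \<Longrightarrow> i' \<in> A \<Longrightarrow> j \<in> B \<Longrightarrow> c i < c i' \<Longrightarrow> c (i + j) < c (i' + j)"
    "\<And>i j j'. i \<in> A \<Longrightarrow> j \<in> B \<Longrightarrow> j' \<in> B \<Longrightarrow> c j < c j' \<Longrightarrow> c (i + j) < c (i + j')"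
    "\<And>i i' j j'. i \<in> A \<Longrightarrow> i' \<in> A \<Longrightarrow> j \<in> B \<Longrightarrow> j' \<in> B \<Longrightarrow> c i = c i' \<Longrightarrow> c j = c j' \<Longrightarrow>
       c (i + j) = c (i' + j')"
    "\<And>t. t < R \<Longrightarrow>
       binary_weight (\<Sum>p | p \<in> A \<times> B \<and> c (fst p + snd p) = t. 2 ^ (fst p + snd p)) > 0"
    "(\<Sum>t<R. binary_weight (\<Sum>p | p \<in> A \<times> B \<and> c (fst p + snd p) = t. 2 ^ (fst p + snd p))) = 4"
proof -
  define h :: "nat \<times> nat \<Rightarrow> nat" where "h = (\<lambda>p. fst p + snd p)"
  define n where "n = a * b"
  define K where "K = active (A \<times> B) h"
  define W where "W = card A * card B"
  have finA: "finite A" and finB: "finite B" by (simp_all add: A_def B_def finite_bits)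
  then have fin: "finite (A \<times> B)" by simp
  have 0: "0 \<in> A" "0 \<in> B" using assms(3,4) by (simp_all add: A_def B_def bit_0)
  have n: "(\<Sum>p\<in>A \<times> B. 2 ^ h p) = n"
    using sum_powers_Times[OF finA finB] by (simp add: h_def n_def A_def B_def sum_bits)
  have M: "Max A \<in> A" "Max B \<in> B" using finA finB 0 by (auto intro: Max_in)
  have "W > 0" using finA finB 0 by (auto simp: W_def card_gt_0_iff)
  have finK: "finite K" and cardK: "card K \<le> W"
    using finite_active[OF fin] card_active[OF fin, of h] by (simp_all add: K_def W_def card_cartesian_product)
  have AB: "i + j \<in> K" if "i \<in> A" "j \<in> B" for i j
    using exponent_active[OF fin, of "(i, j)" h] that by (simp add: K_def h_def)
  have AK: "i \<in> K" if "i \<in> A" for i using AB[OF that 0(2)] by simp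
  have BK: "j \<in> K" if "j \<in> B" for j using AB[OF 0(1) that] by simp
  have Suc_K: "Suc e \<notin> K" if "e \<in> run_ends g K" "g > 0" for e g
    using that by (force simp: run_ends_def)
  have end_bit: "bit n e" if "e \<in> run_ends g K" "g > 0" for e g
    using run_end_bit[OF fin, of e h] Suc_K[OF that] that run_ends_subset[of g K] n by (auto simp: K_def)
  have "run_ends 1 K \<subseteq> {i. bit n i}" using end_bit by auto
  then have card4: "card (run_ends 1 K) \<le> 4"
    using card_mono[OF finite_bits[of n]] w4 by (fastforce simp: binary_weight_def n_def)
  obtain g L where gL: "g > 0" "L > 0" "2 * L \<le> g + 2" "L \<le> 3 * W" "card (run_ends g K) \<ge> 3"
    and short: "\<And>u v. u \<in> K \<Longrightarrow> v \<in> K \<Longrightarrow> u \<le> v \<Longrightarrow> run_ends g K \<inter> {u..<v} = {} \<Longrightarrow> v < u + L"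
    by (rule separating_scale[OF finK cardK card4 \<open>W > 0\<close> AK[OF 0(1)] AK[OF M(1)] BK[OF M(2)] AB[OF M]
          large[folded W_def]]) (rule that)
  define E where "E = run_ends g K"
  define c where "c = cluster E"
  define R where "R = card E"
  have finE: "finite E" using finK run_ends_subset finite_subset unfolding E_def by blast
  have mono: "mono c" using cluster_mono[OF finE] by (simp add: c_def mono_def)
  have near: "v < u + L" if "u \<in> K" "v \<in> K" "c u = c v" for u v
    using that short[of u v] cluster_eq_iff[OF finE, of u v] gL(2)
    by (cases "u \<le> v") (auto simp: c_def E_def)
  have far: "u + g < v" if "v \<in> K" "c u < c v" for u v
  proof -
    have "u \<le> v" using that mono by (metis monoD nat_le_linear not_le)
    then have "E \<inter> {u..<v} \<noteq> {}"
      using that cluster_eq_iff[OF finE, of u v] by (simp add: c_def)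
    then obtain e where "e \<in> E" "u \<le> e" "e < v" by auto
    then show ?thesis using that(1) by (force simp: E_def run_ends_def)
  qed
  have same: "c u = c v" if "u \<in> K" "v \<in> K" "u \<le> v + g" "v \<le> u + g" for u v
    using far[of v u] far[of u v] that by (metis linorder_neqE_nat not_le)
  have cK: "c k < R" if "k \<in> K" for k
  proof -
    have "Max K \<in> E" using Max_in[OF finK] Max_ge[OF finK] that by (auto simp: E_def run_ends_def simp flip: not_le)
    moreover have "k \<le> Max K" using finK that by simp
    ultimately have "Max K \<in> E - {e \<in> E. e < k}" by simp
    then have "{e \<in> E. e < k} \<subset> E" by blast
    then show ?thesis using finE by (simp add: c_def cluster_def R_def psubset_card_mono)
  qed
  have cut: "carry_into (A \<times> B) h (Suc e) = 0" if "e \<in> E" for e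
    using Suc_K[of e g] that gL(1) by (simp add: E_def K_def active_def)
  define F where "F t = (\<Sum>p | p \<in> A \<times> B \<and> c (fst p + snd p) = t. 2 ^ (fst p + snd p) :: nat)" for t
  have Fw: "binary_weight (F t) = card {i. bit n i \<and> c i = t}" if "t < R" for t
  proof -
    have "F t = (\<Sum>i | bit n i \<and> c i = t. 2 ^ i)"
      using sum_cluster[OF fin finE cut, of t] that n by (simp add: F_def c_def R_def h_def)
    then show ?thesis using finite_bits[of n] by (simp add: binary_weight_sum_powers)
  qed
  have Fpos: "binary_weight (F t) > 0" if "t < R" for t
  proof -
    obtain e where "e \<in> E" "c e = t"
      using cluster_threshold[of E "Suc t"] finE \<open>t < R\<close> by (auto simp: c_def R_def)
    then have "e \<in> {i. bit n i \<and> c i = t}" using end_bit[of e g] gL(1) by (simp add: E_def)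
    then show ?thesis using Fw[OF that] finite_bits[of n] by (auto simp: card_gt_0_iff)
  qed
  have Fsum: "(\<Sum>t<R. binary_weight (F t)) = 4"
  proof -
    have bits: "{i. bit n i} = (\<Union>t\<in>{..<R}. {i. bit n i \<and> c i = t})"
      using cK bit_active[OF fin, of h] n by (auto simp: K_def)
    have "(\<Sum>t<R. binary_weight (F t)) = (\<Sum>t<R. card {i. bit n i \<and> c i = t})"
      by (simp add: Fw)
    also have "\<dots> = card {i. bit n i}"
      unfolding bits using finite_bits[of n] by (subst card_UN_disjoint) auto
    finally show ?thesis using w4 by (simp add: binary_weight_def n_def)
  qed
  have "R \<ge> 3" using gL(5) by (simp add: R_def E_def)
  \<comment> \<open>Carries may keep columns beyond all exponents active, so this is not clear from \<open>R\<close> alone: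
    the last cluster contains a summand because its digit sum is not zero.\<close>
  have top: "c (Max A + Max B) = R - 1"
  proof -
    have "F (R - 1) \<noteq> 0" using Fpos[of "R - 1"] \<open>R \<ge> 3\<close> binary_weight_eq_0_iff[of "F (R - 1)"] by simp
    then have "{p. p \<in> A \<times> B \<and> c (fst p + snd p) = R - 1} \<noteq> {}"
      unfolding F_def by (rule contrapos_nn) (simp only: sum.empty)
    then obtain p where p: "p \<in> A \<times> B" "c (fst p + snd p) = R - 1" by auto
    then have "fst p + snd p \<le> Max A + Max B" using finA finB by (auto intro!: add_mono Max_ge)
    then have "R - 1 \<le> c (Max A + Max B)" using monoD[OF mono, of "fst p + snd p"] p(2) by simp
    then show ?thesis using cK[OF AB[OF M]] by simp
  qed
  show ?thesis
  proof (rule that[of c R])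
    show "c (Max A) > 0" "c (Max B) > 0"
      using near[OF AK[OF 0(1)] AK[OF M(1)]] near[OF BK[OF 0(2)] BK[OF M(2)]] large gL(4) \<open>W > 0\<close>
      by (auto simp: c_def W_def intro!: Nat.gr0I)
    show "c (i + j) < c (i' + j)" if "i \<in> A" "i' \<in> A" "j \<in> B" "c i < c i'" for i i' j
    proof -
      have "i + g < i'" using far that AK by blast
      moreover have "c (i + j) \<noteq> c (i' + j)"
        using near[OF AB[OF that(1,3)] AB[OF that(2,3)]] \<open>i + g < i'\<close> gL(2,3) by linarith
      ultimately show ?thesis using monoD[OF mono, of "i + j" "i' + j"] by simp
    qed
    show "c (i + j) < c (i + j')" if "i \<in> A" "j \<in> B" "j' \<in> B" "c j < c j'" for i j j'
    proof -
      have "j + g < j'" using far that BK by blast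
      moreover have "c (i + j) \<noteq> c (i + j')"
        using near[OF AB[OF that(1,2)] AB[OF that(1,3)]] \<open>j + g < j'\<close> gL(2,3) by linarith
      ultimately show ?thesis using monoD[OF mono, of "i + j" "i + j'"] by simp
    qed
    show "c (i + j) = c (i' + j')"
      if "i \<in> A" "i' \<in> A" "j \<in> B" "j' \<in> B" "c i = c i'" "c j = c j'" for i i' j j'
    proof (rule same)
      have "i < i' + L" "i' < i + L" "j < j' + L" "j' < j + L"
        using near[of i i'] near[of i' i] near[of j j'] near[of j' j] that AK BK by simp_all
      then show "i + j \<le> i' + j' + g" "i' + j' \<le> i + j + g" using gL(3) by linarith+
    qed (use AB that in simp_all)
  qed (use mono top \<open>R \<ge> 3\<close> Fpos Fsum in \<open>simp_all add: c_def F_def\<close>)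
qed

theorem theorem2p4:
  fixes l m a b :: nat
  assumes "l \<ge> 3" and "m \<ge> 3"
    and "a \<ge> 1" and "b \<ge> 1"
    and "odd a" and "odd b"
    and "binary_weight a = l" and "binary_weight b = m"
    and "binary_weight (a * b) = 4"
  shows "min a b < 2 ^ (18 * l * m)"
proof (rule ccontr)
  assume "\<not> min a b < 2 ^ (18 * l * m)"
  then have big: "2 ^ (18 * l * m) \<le> a" "2 ^ (18 * l * m) \<le> b" by auto
  define A B where "A = {i. bit a i}" and "B = {j. bit b j}"
  have card: "card A = l" "card B = m" using assms(7,8) by (simp_all add: A_def B_def binary_weight_def)
  have fin: "finite A" "finite B" by (simp_all add: A_def B_def finite_bits)
  have 0: "0 \<in> A" "0 \<in> B" using assms(5,6) by (simp_all add: A_def B_def bit_0)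
  define M N where "M = Max A" and "N = Max B"
  have MN: "M \<in> A" "N \<in> B" and le: "\<And>i. i \<in> A \<Longrightarrow> i \<le> M" "\<And>j. j \<in> B \<Longrightarrow> j \<le> N"
    using fin 0 by (auto simp: M_def N_def intro: Max_in)
  have large: "18 * (card A * card B) \<le> M" "18 * (card A * card B) \<le> N"
    using Max_bits_ge[OF big(1)] Max_bits_ge[OF big(2)]
    by (simp_all add: card M_def N_def mult.assoc flip: A_def B_def)
  obtain c :: "nat \<Rightarrow> nat" and R where c: "mono c" "c 0 = 0" "c M > 0" "c N > 0" "R \<ge> 3" "c (M + N) = R - 1"
    and strictA: "\<And>i i' j. i \<in> A \<Longrightarrow> i' \<in> A \<Longrightarrow> j \<in> B \<Longrightarrow> c i < c i' \<Longrightarrow> c (i + j) < c (i' + j)"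
    and strictB: "\<And>i j j'. i \<in> A \<Longrightarrow> j \<in> B \<Longrightarrow> j' \<in> B \<Longrightarrow> c j < c j' \<Longrightarrow> c (i + j) < c (i + j')"
    and cong: "\<And>i i' j j'. i \<in> A \<Longrightarrow> i' \<in> A \<Longrightarrow> j \<in> B \<Longrightarrow> j' \<in> B \<Longrightarrow> c i = c i' \<Longrightarrow> c j = c j' \<Longrightarrow>
       c (i + j) = c (i' + j')"
    and pos: "\<And>t. t < R \<Longrightarrow>
       binary_weight (\<Sum>p | p \<in> A \<times> B \<and> c (fst p + snd p) = t. 2 ^ (fst p + snd p)) > 0"
    and total: "(\<Sum>t<R. binary_weight (\<Sum>p | p \<in> A \<times> B \<and> c (fst p + snd p) = t. 2 ^ (fst p + snd p))) = 4"
    by (rule product_clusters[OF assms(5,6,9), folded A_def B_def, folded M_def N_def, OF large]) (rule that)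
  define P where "P t = {p. p \<in> A \<times> B \<and> c (fst p + snd p) = t}" for t
  define w where "w t = binary_weight (\<Sum>p\<in>P t. 2 ^ (fst p + snd p))" for t
  have wpos: "w t \<ge> 1" if "t < R" for t using pos[OF that] by (simp add: w_def P_def)
  have wsum: "(\<Sum>t<R. w t) = 4" using total by (simp add: w_def P_def)
  have R: "R \<le> 4" using sum_mono[of "{..<R}" "\<lambda>_. 1" w] wpos wsum by simp
  have cle: "c i \<le> c k" if "i \<le> k" for i k using c(1) that by (rule monoD)
  define A0 A1 B0 B1 where "A0 = {i \<in> A. c i = 0}" and "A1 = {i \<in> A. c i = c M}"
    and "B0 = {j \<in> B. c j = 0}" and "B1 = {j \<in> B. c j = c N}"
  \<comment> \<open>\<open>P t\<close> collects the pairs in cluster \<open>t\<close>, \<open>w t\<close> is the number of ones there; the index 0 stands for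
    the lowest, the index 1 for the highest cluster of each factor.\<close>
  note defs = A0_def A1_def B0_def B1_def
  have fin': "finite A0" "finite A1" "finite B0" "finite B1" using fin by (simp_all add: defs)
  have P0: "P 0 = A0 \<times> B0"
  proof (intro set_eqI iffI)
    fix p assume "p \<in> P 0"
    then show "p \<in> A0 \<times> B0"
      using cle[of "fst p" "fst p + snd p"] cle[of "snd p" "fst p + snd p"] by (auto simp: P_def defs)
  next
    fix p assume "p \<in> A0 \<times> B0"
    then show "p \<in> P 0" using cong[of "fst p" 0 "snd p" 0] 0 c(2) by (auto simp: P_def defs)
  qed
  have Ptop: "P (R - 1) = A1 \<times> B1"
  proof (intro set_eqI iffI)
    fix p assume p: "p \<in> P (R - 1)"
    then obtain i j where ij: "p = (i, j)" "i \<in> A" "j \<in> B" "c (i + j) = R - 1" by (auto simp: P_def)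
    have "\<not> c i < c M" "\<not> c j < c N"
      using strictA[of i M j] strictB[of i j N] cle[of "M + j" "M + N"] cle[of "i + N" "M + N"] le ij MN c(6)
      by auto
    then show "p \<in> A1 \<times> B1" using cle[of i M] cle[of j N] le ij by (auto simp: defs)
  next
    fix p assume "p \<in> A1 \<times> B1"
    then show "p \<in> P (R - 1)" using cong[of "fst p" M "snd p" N] MN c(6) by (auto simp: P_def defs)
  qed
  define s where "s S = (\<Sum>i\<in>S. 2 ^ i :: nat)" for S
  have sw: "binary_weight (s S) = card S" if "finite S" for S
    using that by (simp add: s_def binary_weight_sum_powers)
  have prod: "(\<Sum>p\<in>S \<times> T. 2 ^ (fst p + snd p)) = s S * s T" if "finite S" "finite T" for S T
    using that by (simp add: s_def sum_powers_Times)
  have w0: "w 0 = binary_weight (s A0 * s B0)" and wtop: "w (R - 1) = binary_weight (s A1 * s B1)"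
    using fin' by (simp_all only: w_def P0 Ptop prod)
  have cards0: "card A0 = 1 \<and> card B0 = 1" if "w 0 = 1"
    using binary_weight_mult_eq_1[of "s A0" "s B0"] that w0 fin' by (simp add: sw)
  have cardstop: "card A1 = 1 \<and> card B1 = 1" if "w (R - 1) = 1"
    using binary_weight_mult_eq_1[of "s A1" "s B1"] that wtop fin' by (simp add: sw)
  have midA: "\<exists>i\<in>A. 0 < c i \<and> c i < c M" if "card A0 = 1" "card A1 = 1"
  proof (rule ccontr)
    assume *: "\<not> ?thesis"
    have "A \<subseteq> A0 \<union> A1"
    proof
      fix i assume "i \<in> A"
      then show "i \<in> A0 \<union> A1" using * cle[OF le(1)[of i]] by (auto simp: defs)
    qed
    then have "card A \<le> card A0 + card A1" using fin' card_mono[of "A0 \<union> A1" A] card_Un_le[of A0 A1] by simp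
    then show False using that card assms(1) by simp
  qed
  have midB: "\<exists>j\<in>B. 0 < c j \<and> c j < c N" if "card B0 = 1" "card B1 = 1"
  proof (rule ccontr)
    assume *: "\<not> ?thesis"
    have "B \<subseteq> B0 \<union> B1"
    proof
      fix j assume "j \<in> B"
      then show "j \<in> B0 \<union> B1" using * cle[OF le(2)[of j]] by (auto simp: defs)
    qed
    then have "card B \<le> card B0 + card B1" using fin' card_mono[of "B0 \<union> B1" B] card_Un_le[of B0 B1] by simp
    then show False using that card assms(2) by simp
  qed
  show False
  proof (cases "w 0 = 1 \<and> w (R - 1) = 1")
    case True
    then obtain i j where "i \<in> A" "0 < c i" "c i < c M" "j \<in> B" "0 < c j" "c j < c N"
      using midA midB cards0 cardstop by blast
    \<comment> \<open>Together with the cluster of \<open>0\<close> these are five clusters.\<close>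
    then have "0 < c i" "c i < c (i + j)" "c (i + j) < c (i + N)" "c (i + N) < c (M + N)"
      using strictB[of i 0 j] strictB[of i j N] strictA[of i M N] 0 MN c(2) by auto
    then show False using R c(6) by linarith
  next
    case False
    have R3: "R = 3"
    proof (rule ccontr)
      assume "R \<noteq> 3"
      then have R4: "R = 4" using R c(5) by simp
      then have "w 0 + w 1 + w 2 + w 3 = 4" using wsum by (simp add: eval_nat_numeral)
      moreover have "w 0 \<ge> 1" "w 1 \<ge> 1" "w 2 \<ge> 1" "w 3 \<ge> 1" using wpos R4 by simp_all
      ultimately have "w 0 = 1" "w 3 = 1" by linarith+
      then show False using False R4 by simp
    qed
    then have "w 0 + w 1 + w 2 = 4" using wsum by (simp add: eval_nat_numeral)
    moreover have "w 0 \<ge> 1" "w 1 \<ge> 1" "w 2 \<ge> 1" using wpos R3 by simp_all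
    moreover have "\<not> (w 0 = 1 \<and> w 2 = 1)" using False R3 by simp
    ultimately have w1: "w 1 = 1" and w02: "w 0 = 1 \<and> w 2 = 2 \<or> w 0 = 2 \<and> w 2 = 1"
      by linarith+
    have "c M < c (M + N)" using strictB[OF MN(1) 0(2) MN(2)] c(2,4) by simp
    moreover have "c N < c (M + N)" using strictA[OF 0(1) MN(1) MN(2)] c(2,3) by simp
    ultimately have cross: "c M = 1" "c N = 1" using c(3,4,6) R3 by linarith+
    have splitA: "A \<subseteq> A0 \<union> A1"
    proof
      fix i assume "i \<in> A"
      then show "i \<in> A0 \<union> A1" using cle[OF le(1)[of i]] cross by (auto simp: defs)
    qed
    have splitB: "B \<subseteq> B0 \<union> B1"
    proof
      fix j assume "j \<in> B"
      then show "j \<in> B0 \<union> B1" using cle[OF le(2)[of j]] cross by (auto simp: defs)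
    qed
    have P1: "P 1 = (A0 \<times> B1) \<union> (A1 \<times> B0)"
    proof (intro set_eqI iffI)
      fix p assume p: "p \<in> P 1"
      then have "p \<notin> P 0" "p \<notin> P (R - 1)" using R3 by (auto simp: P_def)
      then have "p \<notin> A0 \<times> B0" "p \<notin> A1 \<times> B1" by (simp_all only: P0 Ptop not_False_eq_True)
      then show "p \<in> (A0 \<times> B1) \<union> (A1 \<times> B0)" using p splitA splitB by (auto simp: P_def)
    next
      fix p assume "p \<in> (A0 \<times> B1) \<union> (A1 \<times> B0)"
      then show "p \<in> P 1"
        using cong[of "fst p" 0 "snd p" N] cong[of "fst p" M "snd p" 0] MN 0 c(2) cross
        by (auto simp: P_def defs)
    qed
    have disj: "(A0 \<times> B1) \<inter> (A1 \<times> B0) = {}" using cross by (auto simp: defs)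
    have "(\<Sum>p\<in>P 1. 2 ^ (fst p + snd p)) = s A0 * s B1 + s A1 * s B0"
      unfolding P1 using fin' disj by (subst sum.union_disjoint) (simp_all add: prod)
    then have mid: "binary_weight (s A0 * s B1 + s B0 * s A1) = 1"
      using w1 by (simp add: w_def mult.commute)
    have "card A0 = 1 \<and> card A1 = 1 \<or> card B0 = 1 \<and> card B1 = 1"
      using w02
    proof
      assume *: "w 0 = 1 \<and> w 2 = 2"
      then have c1: "card A0 = 1" "card B0 = 1" using cards0 by auto
      then obtain i j where "s A0 = 2 ^ i" "s B0 = 2 ^ j"
        using sw[OF fin'(1)] sw[OF fin'(3)] binary_weight_eq_1_iff by metis
      then have "binary_weight (s B1) = 1 \<or> binary_weight (s A1) = 1"
        using sum_power_prod_weight_2[of i "s B1" j "s A1"] mid wtop * R3 by (simp add: mult.commute)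
      then show ?thesis using c1 fin' by (auto simp: sw)
    next
      assume *: "w 0 = 2 \<and> w 2 = 1"
      then have c1: "card A1 = 1" "card B1 = 1" using cardstop R3 by auto
      then obtain i j where "s A1 = 2 ^ i" "s B1 = 2 ^ j"
        using sw[OF fin'(2)] sw[OF fin'(4)] binary_weight_eq_1_iff by metis
      then have "binary_weight (s A0) = 1 \<or> binary_weight (s B0) = 1"
        using sum_power_prod_weight_2[of j "s A0" i "s B0"] mid w0 * by (simp add: mult.commute)
      then show ?thesis using c1 fin' by (auto simp: sw)
    qed
    then show False using midA midB cross by auto
  qed
qed

end
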